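(* Let $0<\lambda\le1$ and let $f(z)=z+\sum_{n\ge2}a_nz^n$ belong to $\mathcal{ST}_{ss}(\lambda)$. Then $|a_n|=\mathrm{O}(1/n)$ for $n=1,2,3,\ldots$.
   Context: $\mathbb{D}=\{z\in\mathbb{C}:|z|<1\}$. $\mathcal{A}$ is the class of holomorphic functions in $\mathbb{D}$ of the form $f(z)=z+\sum_{n\ge 2}a_nz^n$ (so $a_1=1$). $\mathcal{ST}$ is the class of univalent $f\in\mathcal{A}$ with $\Re\{zf'(z)/f(z)\}>0$ in $\mathbb{D}$. For $0<\lambda\le1$, $\mathcal{ST}_{ss}(\lambda)$ is the subfamily of $f\in\mathcal{ST}$ satisfying $zf'(z)/f(z)\prec(1+z)^\lambda$ in $\mathbb{D}$, where the branch of the power equals $1$ at $z=0$ and $p\prec q$ (subordination) means $p=q\circ\omega$ for some analytic $\omega:\mathbb{D}\to\mathbb{D}$ with $\omega(0)=0$. *)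

theory Defs
  imports "HOL-Complex_Analysis.Complex_Analysis" "HOL-Library.Landau_Symbols"
begin

abbreviation unit_disc :: "complex set" where
  "unit_disc \<equiv> ball 0 1"

text \<open>
  \<open>normalized_series f a\<close>: on the unit disc, \<open>f(z) = z + (\<Sum>n\<ge>2. a\<^sub>n z\<^sup>n)\<close>,
  with the convention \<open>a\<^sub>1 = 1\<close>. The value \<open>a 0\<close> is not used.
\<close>
definition normalized_series :: "(complex \<Rightarrow> complex) \<Rightarrow> (nat \<Rightarrow> complex) \<Rightarrow> bool" where
  "normalized_series f a \<longleftrightarrow>
     a 1 = 1 \<and> (\<forall>z\<in>unit_disc. (\<lambda>n. a (n + 2) * z ^ (n + 2)) sums (f z - z))"

definition class_A :: "(complex \<Rightarrow> complex) set" where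
  "class_A = {f. f holomorphic_on unit_disc \<and> (\<exists>a. normalized_series f a)}"

text \<open>
  The function \<open>z f'(z) / f(z)\<close> has a removable singularity at the origin, where its value is \<open>1\<close>
  for \<open>f\<close> in \<open>class_A\<close>; the division convention of HOL would give \<open>0\<close> there instead.
\<close>
definition starlike_quotient :: "(complex \<Rightarrow> complex) \<Rightarrow> complex \<Rightarrow> complex" where
  "starlike_quotient f z = (if z = 0 then 1 else z * deriv f z / f z)"

definition class_ST :: "(complex \<Rightarrow> complex) set" where
  "class_ST = {f \<in> class_A. inj_on f unit_disc \<and>
     (\<forall>z\<in>unit_disc. Re (starlike_quotient f z) > 0)}"

definition subordinate :: "(complex \<Rightarrow> complex) \<Rightarrow> (complex \<Rightarrow> complex) \<Rightarrow> bool"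
    (infix "\<prec>\<^sub>s" 50) where
  "p \<prec>\<^sub>s q \<longleftrightarrow> (\<exists>\<omega>. \<omega> holomorphic_on unit_disc \<and> \<omega> ` unit_disc \<subseteq> unit_disc \<and> \<omega> 0 = 0 \<and>
     (\<forall>z\<in>unit_disc. p z = q (\<omega> z)))"

text \<open>
  For \<open>z\<close> in the unit disc, \<open>1 + z\<close> lies in the right half-plane, so the principal power
  \<^const>\<open>powr\<close> is the holomorphic branch of \<open>(1 + z)\<^sup>\<lambda>\<close> with value \<open>1\<close> at the origin.
\<close>
definition class_ST_ss :: "real \<Rightarrow> (complex \<Rightarrow> complex) set" where
  "class_ST_ss l = {f \<in> class_ST. starlike_quotient f \<prec>\<^sub>s (\<lambda>z. (1 + z) powr of_real l)}"

end

theory Submission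
  imports Defs
begin

text \<open>
  Write \<open>p(z) = z f'(z) / f(z)\<close>. Subordination to \<open>(1 + z)\<^sup>\<lambda>\<close> makes \<open>p\<close> bounded, by
  \<open>2\<^sup>\<lambda> \<le> 2\<close>, and this already forces \<open>f'\<close> to be bounded on the disc. Indeed \<open>f(z) = z g(z)\<close> with
  \<open>g\<close> free of zeros, because \<open>f\<close> is injective, and \<open>g' / g = (p - 1) / z\<close>. Since \<open>p - 1\<close> is bounded
  and vanishes at the origin, the Schwarz lemma bounds \<open>g' / g\<close>; so \<open>log g\<close> is Lipschitz
  on the disc, and \<open>g\<close> is bounded. But \<open>f' = p g\<close>, so \<open>f'\<close> is bounded too
  (\<open>bounded_deriv_of_bounded_starlike_quotient\<close>).

  The Taylor coefficients of \<open>f'\<close> are the numbers \<open>n a\<^sub>n\<close>, and Cauchy's inequality on circles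
  with radii tending to \<open>1\<close> bounds them by the supremum of \<open>|f'|\<close>
  (\<open>norm_coeff_le_of_bounded_deriv\<close>). This is the claim.
\<close>

text \<open>
  Division by \<open>z\<close> preserves a bound on the disc: away from the origin this is
  the Schwarz lemma for \<open>z H(z) / B\<close>, and at the origin its statement on the derivative there.
\<close>
lemma norm_le_of_norm_mult_id_less:
  fixes H :: "complex \<Rightarrow> complex" and B :: real
  assumes hol: "H holomorphic_on ball 0 1"
    and bound: "\<And>z. norm z < 1 \<Longrightarrow> norm (z * H z) < B"
    and z: "norm z < 1"
  shows "norm (H z) \<le> B"
proof -
  have B: "B > 0" using bound[of 0] by simp
  define F where "F = (\<lambda>w. w * H w / of_real B)"
  have F: "F holomorphic_on ball 0 1" "F 0 = 0"
    unfolding F_def using B by (auto intro!: holomorphic_intros hol)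
  have F1: "norm (F w) < 1" if "norm w < 1" for w
    using bound[OF that] B by (simp add: F_def norm_divide divide_simps)
  show ?thesis
  proof (cases "z = 0")
    case False
    have "norm (F z) \<le> norm z"
      by (rule Schwarz_Lemma(1)[OF F F1 z])
    then show ?thesis
      using False B by (simp add: F_def norm_mult norm_divide divide_simps mult_ac)
  next
    case True
    have dH: "(H has_field_derivative deriv H 0) (at 0)"
      by (rule holomorphic_derivI[OF hol]) auto
    have "(F has_field_derivative H 0 / of_real B) (at 0)"
      unfolding F_def using B by (auto intro!: derivative_eq_intros dH)
    then have "deriv F 0 = H 0 / of_real B" by (rule DERIV_imp_deriv)
    with Schwarz_Lemma(2)[OF F F1 z] have "norm (H 0 / of_real B) \<le> 1"
      by simp
    then show ?thesis using B True by (simp add: norm_divide divide_simps)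
  qed
qed

text \<open>
  A holomorphic logarithm of \<open>g\<close> has derivative \<open>g' / g\<close>, so it is Lipschitz with constant \<open>K\<close>
  and varies by at most \<open>K\<close> between the origin and any point of the disc.
\<close>
lemma norm_le_exp_of_bounded_log_deriv:
  fixes g :: "complex \<Rightarrow> complex" and K :: real
  assumes hol: "g holomorphic_on ball 0 1"
    and nz: "\<And>z. norm z < 1 \<Longrightarrow> g z \<noteq> 0"
    and bound: "\<And>z. norm z < 1 \<Longrightarrow> norm (deriv g z / g z) \<le> K"
    and z: "norm z < 1"
  shows "norm (g z) \<le> norm (g 0) * exp K"
proof -
  obtain h where h: "h holomorphic_on ball 0 1" and gh: "\<And>w. w \<in> ball 0 1 \<Longrightarrow> exp (h w) = g w"
    using holomorphic_logarithm_exists[of "ball 0 1" g 0] hol nz by auto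
  have dh: "deriv h w = deriv g w / g w" if w: "w \<in> ball 0 1" for w
  proof -
    have "(h has_field_derivative deriv h w) (at w)"
      by (rule holomorphic_derivI[OF h _ w]) auto
    then have "((\<lambda>w. exp (h w)) has_field_derivative exp (h w) * deriv h w) (at w)"
      by (auto intro!: derivative_eq_intros)
    then have "(g has_field_derivative exp (h w) * deriv h w) (at w)"
      by (rule has_field_derivative_transform_within_open[where S = "ball 0 1"]) (use w gh in auto)
    from DERIV_imp_deriv[OF this] show ?thesis using gh[OF w] nz[of w] w by simp
  qed
  have K: "K \<ge> 0" by (rule order_trans[OF norm_ge_zero bound[of 0]]) simp
  have "norm (h z - h 0) \<le> K * norm (z - 0)"
  proof (rule field_differentiable_bound[where S = "ball 0 1" and f' = "deriv h"])
    show "(h has_field_derivative deriv h w) (at w within ball 0 1)" if "w \<in> ball 0 1" for w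
      by (rule holomorphic_derivI[OF h _ that]) auto
    show "norm (deriv h w) \<le> K" if "w \<in> ball 0 1" for w
      unfolding dh[OF that] using bound[of w] that by simp
  qed (use z in auto)
  also have "\<dots> \<le> K * 1" using K z by (intro mult_left_mono) auto
  finally have "Re (h z - h 0) \<le> K" using complex_Re_le_cmod[of "h z - h 0"] by linarith
  then have "exp (Re (h z)) \<le> exp (Re (h 0)) * exp K"
    by (simp flip: exp_add)
  then show ?thesis using gh[of z] gh[of 0] z norm_exp_eq_Re
    by (metis centre_in_ball mem_ball_0 zero_less_one)
qed

text \<open>
  For the Koebe function \<open>z f'(z) / f(z)\<close> stays in the right half-plane and \<open>f'\<close> is unbounded.
  A bound on the modulus excludes this: it bounds the logarithmic derivative of
  \<open>f(z) / z\<close>, hence \<open>f(z) / z\<close> itself, and \<open>f'\<close> is the product of the two bounded functions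
  \<open>z f'(z) / f(z)\<close> and \<open>f(z) / z\<close>.
\<close>
lemma bounded_deriv_of_bounded_starlike_quotient:
  fixes f :: "complex \<Rightarrow> complex" and B :: real
  assumes hol: "f holomorphic_on unit_disc" and inj: "inj_on f unit_disc" and f0: "f 0 = 0"
    and bound: "\<And>z. norm z < 1 \<Longrightarrow> norm (starlike_quotient f z) \<le> B"
    and z: "norm z < 1"
  shows "norm (deriv f z) \<le> B * (norm (deriv f 0) * exp (B + 2))"
proof -
  obtain g where g: "g holomorphic_on ball 0 1" and fg: "\<And>w. norm w < 1 \<Longrightarrow> f w = w * g w"
    and g0: "deriv f 0 = g 0"
    using Schwarz3[OF hol f0] by blast
  have nz: "g w \<noteq> 0" if w: "norm w < 1" for w
  proof (cases "w = 0")
    case True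
    then show ?thesis
      using holomorphic_injective_imp_regular[OF hol open_ball inj, of 0] g0 by simp
  next
    case False
    then have "f w \<noteq> f 0" using inj_onD[OF inj, of w 0] w by auto
    then show ?thesis using fg[OF w] f0 by auto
  qed
  have df: "deriv f w = g w + w * deriv g w" if w: "norm w < 1" for w
  proof -
    have "(g has_field_derivative deriv g w) (at w)"
      by (rule holomorphic_derivI[OF g]) (use w in auto)
    then have "((\<lambda>w. w * g w) has_field_derivative g w + w * deriv g w) (at w)"
      by (auto intro!: derivative_eq_intros)
    then have "(f has_field_derivative g w + w * deriv g w) (at w)"
      by (rule has_field_derivative_transform_within_open[where S = "ball 0 1"]) (use w fg in auto)
    then show ?thesis by (rule DERIV_imp_deriv)
  qed
  \<comment> \<open>Written with \<open>g\<close>, the quotient needs no case distinction: \<open>deriv f 0 = g 0\<close> makes the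
    right-hand side equal to \<open>1\<close> at the origin.\<close>
  have p: "starlike_quotient f w = deriv f w / g w" if w: "norm w < 1" for w
    using nz[OF w] fg[OF w] g0 by (auto simp: starlike_quotient_def)
  have ld: "norm (deriv g w / g w) \<le> B + 2" if w: "norm w < 1" for w
  proof (rule norm_le_of_norm_mult_id_less[where H = "\<lambda>w. deriv g w / g w", OF _ _ w])
    show "(\<lambda>w. deriv g w / g w) holomorphic_on ball 0 1"
      using nz by (intro holomorphic_intros g) auto
    fix v :: complex assume v: "norm v < 1"
    have "v * (deriv g v / g v) = starlike_quotient f v - 1"
      using nz[OF v] by (simp add: p[OF v] df[OF v] field_simps)
    \<comment> \<open>The bound \<open>|p - 1| \<le> B + 1\<close> is enlarged to \<open>B + 2\<close> to make it strict.\<close>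
    then show "norm (v * (deriv g v / g v)) < B + 2"
      using bound[OF v] norm_triangle_ineq4[of "starlike_quotient f v" 1] by simp
  qed
  have B: "B \<ge> 0" by (rule order_trans[OF norm_ge_zero bound[of 0]]) simp
  have "norm (deriv f z) = norm (starlike_quotient f z) * norm (g z)"
    using nz[OF z] by (simp add: p[OF z] norm_divide)
  also have "\<dots> \<le> B * (norm (g 0) * exp (B + 2))"
    by (intro mult_mono bound z norm_le_exp_of_bounded_log_deriv g nz ld B) auto
  finally show ?thesis by (simp add: g0)
qed

lemma norm_coeff_le_of_bounded_deriv:
  fixes f :: "complex \<Rightarrow> complex" and c :: "nat \<Rightarrow> complex" and M :: real
  assumes sums: "\<And>z. norm z < 1 \<Longrightarrow> (\<lambda>n. c n * z ^ n) sums f z"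
    and hol: "f holomorphic_on ball 0 1"
    and bound: "\<And>z. norm z < 1 \<Longrightarrow> norm (deriv f z) \<le> M"
  shows "real n * norm (c n) \<le> M"
proof (cases n)
  case 0
  have "M \<ge> 0" by (rule order_trans[OF norm_ge_zero bound[of 0]]) simp
  with 0 show ?thesis by simp
next
  case (Suc m)
  have "f has_fps_expansion Abs_fps c"
  proof (rule has_fps_expansionI)
    have "\<forall>\<^sub>F u in nhds 0. u \<in> ball (0 :: complex) 1"
      by (rule eventually_nhds_in_open) auto
    then show "\<forall>\<^sub>F u in nhds 0. (\<lambda>n. fps_nth (Abs_fps c) n * u ^ n) sums f u"
      by eventually_elim (use sums in auto)
  qed
  from fps_nth_fps_expansion[OF this, of n]
  have c: "c n = (deriv ^^ m) (deriv f) 0 / fact n"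
    by (simp add: Suc funpow_Suc_right del: funpow.simps)
  have d: "norm ((deriv ^^ m) (deriv f) 0) \<le> fact m * M / r ^ m" if r: "0 < r" "r < 1" for r
  proof (rule Cauchy_inequality)
    have "deriv f holomorphic_on ball 0 1" by (intro holomorphic_intros hol) auto
    then show "deriv f holomorphic_on ball 0 r"
      by (rule holomorphic_on_subset) (use r in auto)
    from \<open>deriv f holomorphic_on ball 0 1\<close>
    show "continuous_on (cball 0 r) (deriv f)"
      by (intro continuous_on_subset[OF holomorphic_on_imp_continuous_on]) (use r in auto)
  qed (use r bound in auto)
  \<comment> \<open>\<open>deriv f\<close> need not extend to the closed disc, so the radius \<open>1\<close> is reached as a limit.\<close>
  have "\<forall>\<^sub>F r in at_left (1 :: real). norm ((deriv ^^ m) (deriv f) 0) \<le> fact m * M / r ^ m"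
    using eventually_at_left_real[of 0 1] by (auto elim!: eventually_mono intro: d)
  moreover have "((\<lambda>r. fact m * M / r ^ m) \<longlongrightarrow> fact m * M / 1 ^ m) (at_left (1 :: real))"
    by (intro tendsto_intros) auto
  ultimately have "norm ((deriv ^^ m) (deriv f) 0) \<le> fact m * M"
    using tendsto_lowerbound[of _ _ "at_left (1 :: real)"] by fastforce
  moreover have "norm (c n) = norm ((deriv ^^ m) (deriv f) 0) / fact n"
    by (simp only: c norm_divide norm_fact)
  then have "real n * norm (c n) = norm ((deriv ^^ m) (deriv f) 0) / fact m"
    by (simp add: Suc divide_simps mult_ac del: of_nat_Suc)
  ultimately show ?thesis by (simp add: pos_divide_le_eq mult.commute)
qed

lemma norm_starlike_quotient_le:
  assumes l: "0 < l" "l \<le> 1" and f: "f \<in> class_ST_ss l" and z: "norm z < 1"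
  shows "norm (starlike_quotient f z) \<le> 2"
proof -
  obtain w where w: "norm w < 1" "starlike_quotient f z = (1 + w) powr of_real l"
    using f z by (fastforce simp: class_ST_ss_def subordinate_def image_subset_iff)
  have "norm (1 + w) \<le> 2" using norm_triangle_ineq[of 1 w] w by simp
  then have "norm (1 + w) powr l \<le> 2 powr l" using l by (intro powr_mono2) auto
  also have "\<dots> \<le> 2 powr 1" using l by (intro powr_mono) auto
  finally show ?thesis by (simp add: w norm_powr_real_powr')
qed

text \<open>
  The coefficient of index \<open>0\<close> is replaced by \<open>0\<close>, since a normalized series leaves \<open>a 0\<close> arbitrary.
\<close>
lemma normalized_series_sums:
  assumes a: "normalized_series f a" and z: "norm z < 1"
  shows "(\<lambda>n. (if n = 0 then 0 else a n) * z ^ n) sums f z"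
proof -
  let ?t = "\<lambda>n. (if n = 0 then 0 else a n) * z ^ n"
  have "(\<lambda>n. ?t (n + 2)) sums (f z - z)" and "a 1 = 1"
    using a z by (auto simp: normalized_series_def)
  moreover have "(\<Sum>i<2. ?t i) = z" using \<open>a 1 = 1\<close> by (simp add: numeral_2_eq_2)
  ultimately show ?thesis using sums_iff_shift[of ?t 2 "f z - z"] by simp
qed

theorem theorem5p3:
  fixes l :: real and f :: "complex \<Rightarrow> complex" and a :: "nat \<Rightarrow> complex"
  assumes "0 < l" and "l \<le> 1"
    and "f \<in> class_ST_ss l"
    and "normalized_series f a"
  shows "(\<lambda>n. cmod (a n)) \<in> O[principal {1..}](\<lambda>n. 1 / real n)"
proof -
  have hol: "f holomorphic_on unit_disc" and inj: "inj_on f unit_disc"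
    using assms(3) by (auto simp: class_ST_ss_def class_ST_def class_A_def)
  note sums = normalized_series_sums[OF assms(4)]
  have f0: "f 0 = 0"
  proof (rule sums_unique2)
    show "(\<lambda>n. (if n = 0 then 0 else a n) * 0 ^ n) sums f 0" by (rule sums) simp
    have "(\<lambda>n. (if n = 0 then 0 else a n) * 0 ^ n) = (\<lambda>n. 0)" by auto
    then show "(\<lambda>n. (if n = 0 then 0 else a n) * 0 ^ n) sums 0" by simp
  qed
  define M where "M = 2 * (norm (deriv f 0) * exp (2 + 2 :: real))"
  have "norm (deriv f z) \<le> M" if "norm z < 1" for z
    unfolding M_def using norm_starlike_quotient_le[OF assms(1-3)]
    by (intro bounded_deriv_of_bounded_starlike_quotient hol inj f0 that)
  then have coeff: "real n * norm (if n = 0 then 0 else a n) \<le> M" for n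
    by (intro norm_coeff_le_of_bounded_deriv[OF sums hol])
  show ?thesis
  proof (rule landau_o.bigI)
    show "max M 1 > 0" by simp
    show "\<forall>\<^sub>F n in principal {1..}. norm (cmod (a n)) \<le> max M 1 * norm (1 / real n)"
      unfolding eventually_principal
    proof
      fix n :: nat assume "n \<in> {1..}"
      then show "norm (cmod (a n)) \<le> max M 1 * norm (1 / real n)"
        using coeff[of n] by (auto simp: field_simps)
    qed
  qed
qed

end
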